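(* Let $\mathfrak{u}$ be a nonprincipal ultrafilter in $\mathbb{N}$, let $\mathbf{z}=(z_n)$ be a sequence in $\mathbb{D}$ with $\lim_{n\to\infty}|z_n|=1$ that is regular with respect to $\mathfrak{u}$, let $\mathbf{k}=(k_n)$ be a sequence in $\mathbb{N}$ and let $r\in(0,1)$. Suppose that there is $C\in\mathfrak{u}$ such that the disks $D^+(z_n,\sqrt[k_n]{r})$, $n\in C$, are pairwise disjoint, and let $\varphi := \varphi_{\mathbf{z},\mathfrak{u}}^{\mathbf{k},r} = \lim_{\mathfrak{u}}\zeta_{D^+(z_n,\sqrt[k_n]{r})}$. Then either $\varphi\in\mathfrak{M}_{\mathbf{z},\mathfrak{u}}$ or $$\varphi = \sup_{\mathbf{m}\in\mathtt{Comp}_{\mathfrak{u}}(\mathbf{z})}\zeta_{\mathbf{z},\mathfrak{u}}^{\mathbf{m},1}$$ (pointwise supremum on $H^\infty$).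
   Context: $\mathbb{K}$ is an algebraically closed field, complete with respect to a nontrivial nonarchimedean absolute value $|\cdot|$; $\mathbb{D} = \{z \in \mathbb{K} : |z|<1\}$; $\mathbb{N}=\{1,2,\dots\}$. $H^\infty$ is the Banach $\mathbb{K}$-algebra of bounded power series $f(z)=\sum_{n\ge 0} a_n z^n$ on $\mathbb{D}$, with norm $\|f\| = \sup_n |a_n| = \sup_{z\in\mathbb{D}}|f(z)|$. $D^+(z,r)$ is the closed disk with center $z$ and radius $r$, and for a disk $D\subset\mathbb{D}$, $\zeta_D(f) := \sup_{z\in D}|f(z)|$ for $f\in H^\infty$ (a multiplicative seminorm bounded by $\|\cdot\|$). $\lim_{\mathfrak{u}}$ denotes the pointwise limit along $\mathfrak{u}$. A sequence $\mathbf{z}=(z_n)$ in $\mathbb{D}$ is regular with respect to $\mathfrak{u}$ if there is $C\in\mathfrak{u}$ with $\inf_{n\in C}\prod_{m\in C, m\ne n}|z_n-z_m|>0$. $\mathtt{Comp}_{\mathfrak{u}}(\mathbf{z})$ is the set of all sequences $\mathbf{m}=(m_n)$ in $\mathbb{N}$ for which there is $C\in\mathfrak{u}$ with $\inf_{n\in C}\prod_{j\in C, j\ne n}|z_n-z_j|^{m_j}>0$. For $\mathbf{m}\in\mathtt{Comp}_{\mathfrak{u}}(\mathbf{z})$ and $s\in(0,1)$, $\zeta_{\mathbf{z},\mathfrak{u}}^{\mathbf{m},s} := \lim_{\mathfrak{u}}\zeta_{D^+(z_n,\sqrt[m_n]{s})}$, and $\zeta_{\mathbf{z},\mathfrak{u}}^{\mathbf{m},1}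 := \lim_{s\to 1^-}\zeta_{\mathbf{z},\mathfrak{u}}^{\mathbf{m},s}$ (pointwise limit, which exists by monotonicity in $s$). $\mathfrak{M}_{\mathbf{z},\mathfrak{u}} := \{\zeta_{\mathbf{z},\mathfrak{u}}^{\mathbf{m},s} : \mathbf{m}\in\mathtt{Comp}_{\mathfrak{u}}(\mathbf{z}),\ s\in(0,1)\}$. *)

theory Defs
  imports "HOL-Analysis.Analysis"
begin

text \<open>
  Algebraically closed fields, complete with respect to a nontrivial nonarchimedean absolute value
  \<open>absv\<close>. The library's \<open>norm\<close> is restricted to real normed vector spaces, hence the class
  parameter. Nonnegativity, definiteness and \<open>absv (- x) = absv x\<close> follow from \<open>dist_absv\<close> and
  the metric space axioms. The closed disk \<open>D\<^sup>+(a, r)\<close> is \<open>cball a r\<close>.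
\<close>

class complete_alg_closed_nonarch_field = alg_closed_field + complete_space +
  fixes absv :: "'a \<Rightarrow> real"
  assumes dist_absv: "dist x y = absv (x - y)"
    and absv_mult: "absv (x * y) = absv x * absv y"
    and absv_ultrametric: "absv (x + y) \<le> max (absv x) (absv y)"
    and absv_nontrivial: "\<exists>x. x \<noteq> 0 \<and> absv x \<noteq> 1"

definition nonprincipal_ultrafilter :: "'a filter \<Rightarrow> bool" where
  "nonprincipal_ultrafilter u \<longleftrightarrow>
     u \<noteq> bot \<and>
     (\<forall>P. eventually P u \<or> eventually (\<lambda>x. \<not> P x) u) \<and>
     (\<forall>a. u \<noteq> principal {a})"

text \<open>Membership of a set \<open>C\<close> in the collection of large sets of a filter.\<close>

definition large :: "'a set \<Rightarrow> 'a filter \<Rightarrow> bool" where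
  "large C u \<longleftrightarrow> eventually (\<lambda>n. n \<in> C) u"

typedef (overloaded) 'a hinf =
  "{f :: 'a :: complete_alg_closed_nonarch_field fps. bounded (range (fps_nth f))}"
  morphisms fps_of_hinf hinf_of_fps
  by (rule exI[of _ 0]) (auto simp: bounded_def)

definition hinf_eval :: "'a :: complete_alg_closed_nonarch_field hinf \<Rightarrow> 'a \<Rightarrow> 'a" where
  "hinf_eval f x = (\<Sum>n. fps_nth (fps_of_hinf f) n * x ^ n)"

text \<open>The seminorm \<open>\<zeta>\<^sub>D\<close>; it is meaningful for nonempty \<open>D \<subseteq> ball 0 1\<close>.\<close>

definition zeta_disk ::
    "'a :: complete_alg_closed_nonarch_field set \<Rightarrow> 'a hinf \<Rightarrow> real" where
  "zeta_disk D f = (SUP x\<in>D. absv (hinf_eval f x))"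

text \<open>
  The possibly infinite product over an index set \<open>A\<close>, as the limit of its partial products. The
  library's \<^const>\<open>prodinf\<close> is unsuitable, since products tending to 0 have to get the value 0.
  All factors below lie in \<open>[0, 1]\<close>, so the limit exists.
\<close>

definition prod_over :: "(nat \<Rightarrow> real) \<Rightarrow> nat set \<Rightarrow> real" where
  "prod_over a A = lim (\<lambda>N. \<Prod>j\<in>{j\<in>A. j < N}. a j)"

definition regular_seq ::
    "nat filter \<Rightarrow> (nat \<Rightarrow> 'a :: complete_alg_closed_nonarch_field) \<Rightarrow> bool" where
  "regular_seq u z \<longleftrightarrow>
     (\<exists>C. large C u \<and> (INF n\<in>C. prod_over (\<lambda>j. absv (z n - z j)) (C - {n})) > 0)"

definition Comp ::
    "nat filter \<Rightarrow> (nat \<Rightarrow> 'a :: complete_alg_closed_nonarch_field) \<Rightarrow> (nat \<Rightarrow> nat) set" where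
  "Comp u z =
     {m. (\<forall>n. 1 \<le> m n) \<and>
         (\<exists>C. large C u \<and> (INF n\<in>C. prod_over (\<lambda>j. absv (z n - z j) ^ m j) (C - {n})) > 0)}"

text \<open>
  The limit along \<open>u\<close> of the seminorms of the disks \<open>D\<^sup>+(z\<^sub>n, s\<^bsup>1/m\<^sub>n\<^esup>)\<close>. It is defined for
  every sequence \<open>m\<close> of positive integers, compatible or not.
\<close>

definition zeta_lim ::
    "nat filter \<Rightarrow> (nat \<Rightarrow> 'a :: complete_alg_closed_nonarch_field) \<Rightarrow> (nat \<Rightarrow> nat) \<Rightarrow> real
      \<Rightarrow> 'a hinf \<Rightarrow> real" where
  "zeta_lim u z m s = (\<lambda>f. Lim u (\<lambda>n. zeta_disk (cball (z n) (root (m n) s)) f))"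

text \<open>
  The seminorm with parameter \<open>s = 1\<close> is the limit from the left, which is not the value of
  \<open>zeta_lim\<close> at 1 (where the disks would have radius 1).
\<close>

definition zeta_one ::
    "nat filter \<Rightarrow> (nat \<Rightarrow> 'a :: complete_alg_closed_nonarch_field) \<Rightarrow> (nat \<Rightarrow> nat)
      \<Rightarrow> 'a hinf \<Rightarrow> real" where
  "zeta_one u z m = (\<lambda>f. Lim (at_left 1) (\<lambda>s. zeta_lim u z m s f))"

definition M_set ::
    "nat filter \<Rightarrow> (nat \<Rightarrow> 'a :: complete_alg_closed_nonarch_field) \<Rightarrow> ('a hinf \<Rightarrow> real) set" where
  "M_set u z = {zeta_lim u z m s | m s. m \<in> Comp u z \<and> s \<in> {0<..<1}}"

end

theory Submission
  imports Defs
begin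

text \<open>
  Write \<open>D\<^sub>n\<close> for the disk with center \<open>z\<^sub>n\<close> and radius \<open>\<rho>\<^sub>n = r\<^bsup>1/k\<^sub>n\<^esup>\<close>. If \<open>k\<close> is compatible,
  then \<open>\<phi>\<close> lies in the set \<open>M_set u z\<close> by definition. So let \<open>k\<close> be incompatible; then \<open>\<phi> f\<close>
  is even the maximum of \<open>zeta_one u z m f\<close> over all compatible \<open>m\<close>, for each \<open>f\<close>.

  Every value is at most \<open>\<phi> f\<close>: compatibility survives multiplication of the exponents by a
  constant and passage to smaller exponents (\<open>Comp_if_eventually_le_mult\<close>). Hence, for every
  compatible \<open>m\<close>, the quotient \<open>k\<^sub>n / m\<^sub>n\<close> tends to infinity along \<open>u\<close>, and the disk around \<open>z\<^sub>n\<close> of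
  radius \<open>s\<^bsup>1/m\<^sub>n\<^esup>\<close> is eventually contained in \<open>D\<^sub>n\<close>, whatever \<open>s < 1\<close> is
  (\<open>eventually_root_le_root\<close>).

  For the maximum to be attained at a given \<open>f\<close> with \<open>\<phi> f > 0\<close>, the exponents have to be adapted to
  the zeros of \<open>f\<close>. Let \<open>N\<^sub>n\<close> be the number of those at distance less than \<open>\<rho>\<^sub>n\<close> from \<open>z\<^sub>n\<close>
  (\<open>zero_order\<close>), and \<open>m\<^sub>n = N\<^sub>n + 1\<close>. A nonarchimedean version of Jensen's inequality says
  that the zeros in the other disks \<open>D\<^sub>j\<close>, all of which are at distance \<open>\<bar>z\<^sub>n - z\<^sub>j\<bar>\<close> from the points of \<open>D\<^sub>n\<close>, force
  \<open>\<zeta>\<^bsub>D\<^sub>n\<^esub>(f) \<le> \<parallel>f\<parallel> \<Prod>\<^sub>j \<bar>z\<^sub>n - z\<^sub>j\<bar>\<^bsup>N\<^sub>j\<^esup>\<close>. As the left-hand side stays away from 0 along \<open>u\<close>,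
  so do the products, and together with the regularity of \<open>z\<close> this makes \<open>m\<close> compatible
  (\<open>Suc_zero_order_mem_Comp\<close>). On the other hand, shrinking the radius of \<open>D\<^sub>n\<close> to
  \<open>\<sigma>\<^sub>n = s\<^bsup>1/m\<^sub>n\<^esup>\<close> multiplies the seminorm of \<open>f\<close> by at least
  \<open>(\<sigma>\<^sub>n/\<rho>\<^sub>n)\<^bsup>N\<^sub>n\<^esup> \<ge> \<sigma>\<^sub>n\<^bsup>m\<^sub>n\<^esup> = s\<close>. Letting \<open>s\<close> tend to 1 gives
  \<open>\<phi> f \<le> zeta_one u z m f\<close> (\<open>zeta_lim_le_zeta_one_zero_order\<close>).

  Both facts about zeros are first proved for polynomials, which split into linear factors, and then
  transferred to power series through their truncations.
\<close>

section \<open>The absolute value\<close>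

lemma absv_0 [simp]: "absv 0 = 0"
  using dist_absv[of 0 0] by simp

lemma absv_nonneg [simp]: "absv x \<ge> 0"
  using dist_absv[of x 0] by (metis diff_zero zero_le_dist)

lemma absv_eq_0_iff [simp]: "absv x = 0 \<longleftrightarrow> x = 0"
  using dist_absv[of x 0] by (metis diff_zero dist_eq_0_iff)

lemma absv_1 [simp]: "absv 1 = 1"
  using absv_mult[of 1 1] by simp

lemma absv_diff_commute: "absv (x - y) = absv (y - x)"
  by (metis dist_absv dist_commute)

lemma absv_minus [simp]: "absv (- x) = absv x"
  using absv_diff_commute[of 0 x] by simp

lemma absv_diff_le_max: "absv (x - y) \<le> max (absv (x - w)) (absv (w - y))"
  using absv_ultrametric[of "x - w" "w - y"] by simp

lemma absv_diff_le_max': "absv (x - y) \<le> max (absv x) (absv y)"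
  using absv_diff_le_max[of x y 0] by simp

lemma absv_power: "absv (x ^ n) = absv x ^ n"
  by (induction n) (auto simp: absv_mult)

lemma absv_inverse: "absv (inverse x) = inverse (absv x)"
proof (cases "x = 0")
  case False
  then have "absv x * absv (inverse x) = 1"
    by (simp flip: absv_mult)
  then show ?thesis
    by (metis inverse_unique)
qed simp

lemma absv_power_int: "absv (x powi n) = absv x powi n"
  by (simp add: power_int_def absv_power absv_inverse)

lemma absv_prod_mset: "absv (\<Prod>w\<in>#A. g w) = (\<Prod>w\<in>#A. absv (g w))"
  by (induction A) (auto simp: absv_mult)

lemma prod_mset_absv_nonneg: "0 \<le> (\<Prod>w\<in>#A. absv (g w))"
  by (induction A) auto

lemma absv_sum_le:
  assumes "B \<ge> 0" "\<And>i. i \<in> I \<Longrightarrow> absv (g i) \<le> B"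
  shows "absv (sum g I) \<le> B"
  using assms
proof (induction I rule: infinite_finite_induct)
  case (insert i I)
  then show ?case
    using absv_ultrametric[of "g i" "sum g I"] by (fastforce simp: max_def split: if_splits)
qed auto

text \<open>In a nonarchimedean triangle, the two longest sides have equal length.\<close>

lemma absv_diff_eq_max:
  assumes "absv (x - w) \<noteq> absv (w - y)"
  shows "absv (x - y) = max (absv (x - w)) (absv (w - y))"
  using absv_diff_le_max[of x y w] absv_diff_le_max[of x w y] absv_diff_le_max[of w y x] assms
  by (auto simp: max_def absv_diff_commute split: if_splits)

text \<open>
  The value group is dense: it contains some \<open>\<alpha> > 1\<close>, and with it, since roots exist, all
  rational powers of \<open>\<alpha>\<close>.
\<close>

lemma absv_dense:
  assumes "0 < a" "a < b"
  shows "\<exists>y :: 'a :: complete_alg_closed_nonarch_field. a < absv y \<and> absv y < b"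
proof -
  obtain x0 :: 'a where x0: "x0 \<noteq> 0" "absv x0 \<noteq> 1"
    using absv_nontrivial by blast
  then have pos: "absv x0 > 0"
    by (simp add: order_less_le)
  obtain x :: 'a where x: "absv x > 1"
  proof (cases "absv x0 > 1")
    case False
    then have "absv (inverse x0) > 1"
      using x0 pos by (simp add: absv_inverse one_less_inverse_iff)
    then show ?thesis using that by blast
  qed
  define l where "l = ln (absv x)"
  have l: "l > 0"
    using x by (simp add: l_def)
  have "ln a / l < ln b / l"
    using assms l by (simp add: divide_strict_right_mono)
  then obtain q where q: "q \<in> \<rat>" "ln a / l < q" "q < ln b / l"
    using Rats_dense_in_real by blast
  obtain i n where qn: "n > 0" "q = of_int i / of_int n"
    using q(1) by (elim Rats_cases')
  obtain y where y: "y ^ nat n = x powi i"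
    using nth_root_exists[of "nat n" "x powi i"] qn by auto
  have "absv y ^ nat n = absv x powi i"
    by (metis y absv_power absv_power_int)
  moreover have "absv x powi i > 0"
    using x by (intro zero_less_power_int) auto
  ultimately have "absv y \<noteq> 0" and "ln (absv y ^ nat n) = ln (absv x powi i)"
    using qn(1) by (auto simp: power_0_left)
  moreover from this(1) have ynz: "absv y > 0"
    using absv_nonneg[of y] by linarith
  ultimately have "ln (absv y ^ nat n) = ln (absv x powi i)"
    by blast
  moreover have "ln (absv x powi i) = of_int i * l"
    using x by (subst powr_real_of_int'[symmetric]) (auto simp: l_def ln_powr)
  ultimately have "of_int n * ln (absv y) = of_int n * (q * l)"
    using qn ynz by (simp add: ln_realpow)
  then have "ln (absv y) = q * l"
    using qn(1) by simp
  then have "ln a < ln (absv y)" "ln (absv y) < ln b"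
    using q l by (simp_all add: field_simps)
  then show ?thesis
    using assms ynz by auto
qed

lemma absv_dense_avoiding:
  assumes "0 < a" "a < b" "finite E"
  shows "\<exists>y :: 'a :: complete_alg_closed_nonarch_field. a < absv y \<and> absv y < b \<and> absv y \<notin> E"
proof -
  \<comment> \<open>No element of \<open>E\<close> lies strictly between \<open>a\<close> and \<open>b'\<close>.\<close>
  define b' where "b' = Min (insert b {e\<in>E. e > a})"
  have b': "a < b'" "b' \<le> b" "\<And>e. e \<in> E \<Longrightarrow> e > a \<Longrightarrow> b' \<le> e"
    using assms by (auto simp: b'_def)
  then show ?thesis
    using absv_dense[of a b'] assms by force
qed

lemma cball_subset_unit_ball:
  assumes "(z :: 'a :: complete_alg_closed_nonarch_field) \<in> ball 0 1" "\<rho> < 1"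
  shows "cball z \<rho> \<subseteq> ball 0 1"
proof
  fix x assume "x \<in> cball z \<rho>"
  then show "x \<in> ball 0 1"
    using assms absv_diff_le_max[of 0 x z] by (auto simp: dist_absv)
qed

lemma absv_diff_less_1:
  assumes "x \<in> ball 0 1" "y \<in> ball 0 1"
  shows "absv (x - y) < 1"
  using assms absv_diff_le_max[of x y 0] by (auto simp: dist_absv)

text \<open>Distances between points of two disjoint disks depend on the disks alone.\<close>

lemma absv_diff_le_of_disjoint_cballs:
  assumes "cball z \<rho> \<inter> cball z' \<rho>' = {}" "0 \<le> \<rho>" "0 \<le> \<rho>'"
    and "x \<in> cball z \<rho>" "w \<in> cball z' \<rho>'"
  shows "absv (x - w) \<le> absv (z - z')"
proof -
  have "z' \<notin> cball z \<rho>" "z \<notin> cball z' \<rho>'"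
    using assms(1-3) by force+
  then have "\<rho> \<le> absv (z - z')" "\<rho>' \<le> absv (z - z')"
    by (auto simp: dist_absv absv_diff_commute)
  then show ?thesis
    using absv_diff_le_max[of x w z] absv_diff_le_max[of z w z'] assms(4,5)
    by (auto simp: dist_absv absv_diff_commute)
qed

section \<open>Polynomials\<close>

definition gauss_norm :: "'a :: complete_alg_closed_nonarch_field poly \<Rightarrow> real" where
  "gauss_norm p = Max ((\<lambda>i. absv (coeff p i)) ` {..degree p})"

lemma absv_coeff_le_gauss_norm: "absv (coeff p i) \<le> gauss_norm p"
proof (cases "i \<le> degree p")
  case True
  then show ?thesis by (auto simp: gauss_norm_def)
next
  case False
  have "0 \<le> absv (coeff p 0)" by simp
  also have "\<dots> \<le> gauss_norm p" unfolding gauss_norm_def by (intro Max_ge) auto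
  finally show ?thesis using False by (simp add: coeff_eq_0)
qed

text \<open>
  One half of the multiplicativity of the Gauss norm. For \<open>\<bar>w\<bar> \<le> 1\<close>, let \<open>i\<close> be the last index at
  which the coefficients of \<open>p\<close> attain their maximal absolute value; then coefficient \<open>i + 1\<close> of the
  product is dominated by coefficient \<open>i\<close> of \<open>p\<close>. For \<open>\<bar>w\<bar> > 1\<close>, coefficient \<open>i\<close> of the product is
  dominated by \<open>w\<close> times coefficient \<open>i\<close> of \<open>p\<close>.
\<close>

lemma gauss_norm_linear_factor_ge:
  fixes w :: "'a :: complete_alg_closed_nonarch_field"
  shows "max 1 (absv w) * gauss_norm p \<le> gauss_norm ([:- w, 1:] * p)"
proof (cases "p = 0")
  case True
  then show ?thesis by (simp add: gauss_norm_def)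
next
  case False
  let ?q = "[:- w, 1:] * p"
  define G where "G = gauss_norm p"
  define I where "I = {i\<in>{..degree p}. absv (coeff p i) = G}"
  have "G \<in> (\<lambda>i. absv (coeff p i)) ` {..degree p}"
    unfolding G_def gauss_norm_def by (intro Max_in) auto
  then have "I \<noteq> {}" "finite I" by (auto simp: I_def)
  define i where "i = Max I"
  have i: "absv (coeff p i) = G"
    using Max_in[OF \<open>finite I\<close> \<open>I \<noteq> {}\<close>] by (auto simp: I_def i_def)
  have "0 < absv (lead_coeff p)"
    using False by (simp add: order_less_le)
  then have "G > 0"
    using absv_coeff_le_gauss_norm[of p "degree p"] by (simp add: G_def)
  have "Suc i \<notin> I"
    using Max_ge[OF \<open>finite I\<close>, of "Suc i"] by (auto simp: i_def)
  then have Suc_i: "absv (coeff p (Suc i)) < G"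
    using absv_coeff_le_gauss_norm[of p "Suc i"] \<open>G > 0\<close>
    by (cases "Suc i \<le> degree p") (auto simp: I_def G_def coeff_eq_0 order_less_le)
  show ?thesis
  proof (cases "absv w \<le> 1")
    case True
    have "absv (w * coeff p (Suc i)) < G"
      using True Suc_i mult_left_le_one_le[of "absv (coeff p (Suc i))" "absv w"]
      by (simp add: absv_mult)
    then have "absv (coeff p i - w * coeff p (Suc i)) = G"
      using absv_diff_eq_max[of "coeff p i" 0 "w * coeff p (Suc i)"] i by simp
    then have "G \<le> gauss_norm ?q"
      using absv_coeff_le_gauss_norm[of ?q "Suc i"] by (simp add: algebra_simps)
    then show ?thesis using True by (simp add: G_def max_def)
  next
    case False
    have "absv w * G = absv (coeff ?q i)"
    proof (cases i)
      case 0
      then show ?thesis using i by (simp add: absv_mult)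
    next
      case (Suc k)
      have "absv (coeff p k) \<le> G"
        unfolding G_def by (rule absv_coeff_le_gauss_norm)
      also have "G < absv w * G"
        using False \<open>G > 0\<close> by simp
      finally have "absv (coeff p k - w * coeff p i) = absv w * G"
        using absv_diff_eq_max[of "coeff p k" 0 "w * coeff p i"] i by (simp add: absv_mult)
      then show ?thesis using Suc by simp
    qed
    also have "\<dots> \<le> gauss_norm ?q"
      by (rule absv_coeff_le_gauss_norm)
    finally show ?thesis using False by (simp add: G_def max_def)
  qed
qed

lemma poly_conv_proots:
  fixes p :: "'a :: alg_closed_field poly"
  assumes "p \<noteq> 0"
  shows "p = smult (lead_coeff p) (\<Prod>w\<in>#proots p. [:- w, 1:])"
proof -
  obtain A where A: "p = smult (lead_coeff p) (\<Prod>w\<in>#A. [:- w, 1:])"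
    using alg_closed_imp_factorization[OF assms] by blast
  have "proots (\<Prod>w\<in>#A. [:- w, 1:]) = A"
  proof (induction A)
    case (add w A)
    have "(\<Prod>w\<in>#A. [:- w, 1:]) \<noteq> 0" by (auto simp: prod_mset_zero_iff)
    then show ?case
      using add by (simp add: proots_mult del: mult_pCons_left)
  qed simp
  then have "proots p = A"
    using assms by (subst A) simp
  then show ?thesis using A by simp
qed

lemma lead_coeff_roots_le_gauss_norm:
  fixes p :: "'a :: complete_alg_closed_nonarch_field poly"
  shows "absv (lead_coeff p) * (\<Prod>w\<in>#proots p. max 1 (absv w)) \<le> gauss_norm p"
proof (cases "p = 0")
  case False
  have "absv c * (\<Prod>w\<in>#A. max 1 (absv w)) \<le> gauss_norm (smult c (\<Prod>w\<in>#A. [:- w, 1:]))"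
    for c :: 'a and A
  proof (induction A)
    case empty
    then show ?case using absv_coeff_le_gauss_norm[of "[:c:]" 0] by simp
  next
    case (add w A)
    let ?Q = "smult c (\<Prod>w\<in>#A. [:- w, 1:])"
    have "absv c * (\<Prod>w\<in>#add_mset w A. max 1 (absv w)) \<le> max 1 (absv w) * gauss_norm ?Q"
      using mult_left_mono[OF add, of "max 1 (absv w)"] by (simp add: algebra_simps)
    also have "\<dots> \<le> gauss_norm ([:- w, 1:] * ?Q)"
      by (rule gauss_norm_linear_factor_ge)
    finally show ?case
      by (simp del: mult_pCons_left flip: mult_smult_right)
  qed
  from this[of "lead_coeff p" "proots p"] show ?thesis
    using poly_conv_proots[OF False] by simp
qed (simp add: gauss_norm_def)

lemma absv_poly_conv_proots:
  fixes p :: "'a :: complete_alg_closed_nonarch_field poly"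
  shows "absv (poly p x) = absv (lead_coeff p) * (\<Prod>w\<in>#proots p. absv (x - w))"
proof (cases "p = 0")
  case False
  have "poly p x = lead_coeff p * (\<Prod>w\<in>#proots p. x - w)"
    by (subst poly_conv_proots[OF False]) (simp add: poly_prod_mset image_mset.compositionality o_def)
  then show ?thesis by (simp add: absv_mult absv_prod_mset)
qed simp

text \<open>Roots are counted with multiplicity.\<close>

definition root_count :: "'a :: idom poly \<Rightarrow> 'a set \<Rightarrow> nat" where
  "root_count p D = size (filter_mset (\<lambda>w. w \<in> D) (proots p))"

text \<open>
  The polynomial form of Jensen's inequality. In the factorization of \<open>\<bar>p(x)\<bar>\<close>, a root \<open>w\<close> in \<open>D j\<close>
  contributes at most \<open>t j\<close>, and every other root at most \<open>max 1 \<bar>w\<bar>\<close>, since \<open>\<bar>x\<bar> \<le> 1\<close>. The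
  numbers \<open>max 1 \<bar>w\<bar>\<close> and the leading coefficient are absorbed by the Gauss norm.
\<close>

lemma absv_poly_le_roots_in_disjoint_sets:
  fixes p :: "'a :: complete_alg_closed_nonarch_field poly"
  assumes "finite F" "disjoint_family_on D F"
    and t: "\<And>j w. j \<in> F \<Longrightarrow> w \<in> D j \<Longrightarrow> absv (x - w) \<le> t j"
    and t0: "\<And>j. j \<in> F \<Longrightarrow> 0 \<le> t j"
    and x: "absv x \<le> 1"
  shows "absv (poly p x) \<le> gauss_norm p * (\<Prod>j\<in>F. t j ^ root_count p (D j))"
proof -
  let ?N = "\<lambda>A j. size (filter_mset (\<lambda>w. w \<in> D j) A)"
  have *: "(\<Prod>w\<in>#A. absv (x - w)) \<le> (\<Prod>w\<in>#A. max 1 (absv w)) * (\<Prod>j\<in>F. t j ^ ?N A j)" for A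
  proof (induction A)
    case (add w A)
    let ?M = "\<Prod>w\<in>#A. max 1 (absv w)" and ?P = "\<Prod>j\<in>F. t j ^ ?N A j"
    have P: "(\<Prod>j\<in>F. t j ^ ?N (add_mset w A) j) = ?P * (\<Prod>j\<in>F. if w \<in> D j then t j else 1)"
      unfolding prod.distrib[symmetric] by (intro prod.cong) auto
    have xw: "absv (x - w) \<le> max 1 (absv w)"
      using absv_diff_le_max'[of x w] x by auto
    have "absv (x - w) \<le> max 1 (absv w) * (\<Prod>j\<in>F. if w \<in> D j then t j else 1)"
    proof (cases "\<exists>i\<in>F. w \<in> D i")
      case True
      then obtain i where i: "i \<in> F" "w \<in> D i" by blast
      have "w \<in> D j \<longleftrightarrow> j = i" if "j \<in> F" for j
        using i that assms(2) by (auto simp: disjoint_family_on_def)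
      then have "(\<Prod>j\<in>F. if w \<in> D j then t j else 1) = (\<Prod>j\<in>F. if j = i then t j else 1)"
        by (intro prod.cong) auto
      also have "\<dots> = t i" using i assms(1) by simp
      finally show ?thesis
        using t[OF i] t0[OF i(1)] mult_right_mono[of 1 "max 1 (absv w)" "t i"] by simp
    next
      case False
      then have "(\<Prod>j\<in>F. if w \<in> D j then t j else 1) = 1" by (intro prod.neutral) auto
      then show ?thesis using xw by simp
    qed
    moreover have "0 \<le> max 1 (absv w) * (\<Prod>j\<in>F. if w \<in> D j then t j else 1)"
      by (intro mult_nonneg_nonneg prod_nonneg) (auto simp: t0)
    ultimately show ?case
      unfolding P using mult_mono[OF _ add _ prod_mset_absv_nonneg, of "absv (x - w)"
          "max 1 (absv w) * (\<Prod>j\<in>F. if w \<in> D j then t j else 1)"]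
      by (simp add: mult_ac)
  qed simp
  have "absv (poly p x) \<le> absv (lead_coeff p) *
          ((\<Prod>w\<in>#proots p. max 1 (absv w)) * (\<Prod>j\<in>F. t j ^ root_count p (D j)))"
    unfolding absv_poly_conv_proots root_count_def by (intro mult_left_mono *) auto
  also have "\<dots> \<le> gauss_norm p * (\<Prod>j\<in>F. t j ^ root_count p (D j))"
    unfolding mult.assoc[symmetric]
    by (intro mult_right_mono lead_coeff_roots_le_gauss_norm prod_nonneg) (auto simp: t0)
  finally show ?thesis .
qed

text \<open>
  Choose \<open>y\<close> at a distance from \<open>z\<close> between \<open>a\<close> and \<open>\<sigma>\<close> that differs from the distances of all
  roots from \<open>z\<close>. Then \<open>\<bar>y - w\<bar> = max \<bar>y - z\<bar> \<bar>z - w\<bar>\<close> for every root \<open>w\<close>. So replacing \<open>x\<close> by \<open>y\<close> shrinks the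
  linear factor of a root inside the disk of radius \<open>\<rho>\<close> at most by \<open>a / \<rho>\<close>, and that of a root
  outside not at all. The slack between \<open>a\<close> and \<open>\<sigma>\<close> is there because \<open>\<sigma>\<close> may be outside the value
  group or equal to one of the forbidden distances.
\<close>

lemma absv_poly_ge_on_smaller_disk:
  fixes p :: "'a :: complete_alg_closed_nonarch_field poly"
  assumes "0 < a" "a < \<sigma>" "\<sigma> \<le> \<rho>" "x \<in> cball z \<rho>"
  shows "\<exists>y\<in>cball z \<sigma>. (a / \<rho>) ^ root_count p (cball z \<rho>) * absv (poly p x) \<le> absv (poly p y)"
proof -
  let ?E = "(\<lambda>w. absv (z - w)) ` set_mset (proots p)"
  obtain h :: 'a where h: "a < absv h" "absv h < \<sigma>" "absv h \<notin> ?E"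
    using absv_dense_avoiding[of a \<sigma> ?E] assms by blast
  define y where "y = z + h"
  have y: "y \<in> cball z \<sigma>"
    using h by (simp add: y_def dist_absv)
  let ?N = "\<lambda>A. size (filter_mset (\<lambda>w. w \<in> cball z \<rho>) A)"
  \<comment> \<open>The restriction on \<open>A\<close> keeps its elements at distances from \<open>z\<close> that \<open>h\<close> avoids.\<close>
  have *: "(a / \<rho>) ^ ?N A * (\<Prod>w\<in>#A. absv (x - w)) \<le> (\<Prod>w\<in>#A. absv (y - w))"
    if "A \<subseteq># proots p" for A
    using that
  proof (induction A)
    case (add w A)
    have "absv (z - w) \<in> ?E"
      using add.prems by (auto dest: mset_subset_eqD)
    then have yw: "absv (y - w) = max (absv h) (absv (z - w))"
      using absv_diff_eq_max[of y z w] h(3) by (simp add: y_def) metis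
    have xw: "absv (x - w) \<le> max \<rho> (absv (z - w))"
      using absv_diff_le_max[of x w z] assms(4) by (auto simp: dist_absv absv_diff_commute)
    have factor: "(if w \<in> cball z \<rho> then a / \<rho> else 1) * absv (x - w) \<le> absv (y - w)"
    proof (cases "w \<in> cball z \<rho>")
      case True
      then have "absv (x - w) \<le> \<rho>" using xw by (simp add: dist_absv)
      then have "a / \<rho> * absv (x - w) \<le> a / \<rho> * \<rho>"
        using assms by (intro mult_left_mono) auto
      also have "\<dots> \<le> absv (y - w)" using yw h assms by simp
      finally show ?thesis using True by simp
    next
      case False
      then show ?thesis using xw yw by (auto simp: dist_absv)
    qed
    have "A \<subseteq># proots p"
      using add.prems by (meson mset_subset_eq_insertD subset_mset.less_imp_le)
    moreover have "0 \<le> (a / \<rho>) ^ ?N A * (\<Prod>w\<in>#A. absv (x - w))"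
      using assms by (intro mult_nonneg_nonneg prod_mset_absv_nonneg) auto
    ultimately show ?case
      using mult_mono[OF factor add.IH] by (simp add: mult_ac split: if_splits)
  qed simp
  have "(a / \<rho>) ^ root_count p (cball z \<rho>) * absv (poly p x) =
      absv (lead_coeff p) * ((a / \<rho>) ^ ?N (proots p) * (\<Prod>w\<in>#proots p. absv (x - w)))"
    by (simp add: absv_poly_conv_proots root_count_def)
  also have "\<dots> \<le> absv (poly p y)"
    unfolding absv_poly_conv_proots by (intro mult_left_mono *) auto
  finally show ?thesis using y by blast
qed

section \<open>Bounded power series on disks\<close>

definition truncation :: "'a :: complete_alg_closed_nonarch_field hinf \<Rightarrow> nat \<Rightarrow> 'a poly" where
  "truncation f T = (\<Sum>i<T. monom (fps_nth (fps_of_hinf f) i) i)"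

text \<open>The norm of \<open>f\<close> is the least such \<open>B\<close>.\<close>

definition coeff_bound :: "'a :: complete_alg_closed_nonarch_field hinf \<Rightarrow> real \<Rightarrow> bool" where
  "coeff_bound f B \<longleftrightarrow> (\<forall>i. absv (fps_nth (fps_of_hinf f) i) \<le> B)"

lemma coeff_bound_exists: "\<exists>B>0. coeff_bound f B"
proof -
  have "bounded (range (fps_nth (fps_of_hinf f)))"
    using fps_of_hinf[of f] by simp
  then obtain e where e: "\<forall>y\<in>range (fps_nth (fps_of_hinf f)). dist 0 y \<le> e"
    using bounded_any_center by blast
  then have "coeff_bound f (max 1 e)"
    by (auto simp: coeff_bound_def dist_absv le_max_iff_disj)
  then show ?thesis
    by (intro exI[of _ "max 1 e"]) auto
qed

lemma coeff_bound_nonneg: "coeff_bound f B \<Longrightarrow> 0 \<le> B"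
  using absv_nonneg order_trans unfolding coeff_bound_def by blast

lemma gauss_norm_truncation_le:
  assumes "coeff_bound f B"
  shows "gauss_norm (truncation f T) \<le> B"
proof -
  have "coeff (truncation f T) i = (if i < T then fps_nth (fps_of_hinf f) i else 0)" for i
    by (simp add: truncation_def coeff_sum)
  then show ?thesis
    using assms coeff_bound_nonneg[OF assms]
    by (auto simp: gauss_norm_def coeff_bound_def)
qed

lemma poly_truncation:
  "poly (truncation f T) x = (\<Sum>i<T. fps_nth (fps_of_hinf f) i * x ^ i)"
  by (simp add: truncation_def poly_sum poly_monom)

lemma absv_poly_truncation_diff_le:
  assumes "coeff_bound f B" "absv x \<le> 1" "S \<le> T"
  shows "absv (poly (truncation f T) x - poly (truncation f S) x) \<le> B * absv x ^ S"
proof -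
  have "poly (truncation f T) x - poly (truncation f S) x
      = (\<Sum>i=S..<T. fps_nth (fps_of_hinf f) i * x ^ i)"
    using assms(3) by (simp add: poly_truncation lessThan_atLeast0 sum_diff_nat_ivl)
  also have "absv \<dots> \<le> B * absv x ^ S"
  proof (rule absv_sum_le)
    show "0 \<le> B * absv x ^ S"
      using coeff_bound_nonneg[OF assms(1)] by simp
    show "absv (fps_nth (fps_of_hinf f) i * x ^ i) \<le> B * absv x ^ S" if "i \<in> {S..<T}" for i
      unfolding absv_mult absv_power using that assms coeff_bound_nonneg[OF assms(1)]
      by (intro mult_mono power_decreasing) (auto simp: coeff_bound_def)
  qed
  finally show ?thesis .
qed

lemma truncation_tendsto:
  assumes "x \<in> ball 0 1"
  shows "(\<lambda>T. poly (truncation f T) x) \<longlonglongrightarrow> hinf_eval f x"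
proof -
  obtain B where B: "coeff_bound f B" "B > 0"
    using coeff_bound_exists by blast
  have x: "absv x < 1"
    using assms by (simp add: dist_absv)
  have "Cauchy (\<lambda>T. poly (truncation f T) x)"
    unfolding Cauchy_altdef
  proof (intro allI impI)
    fix e :: real assume "e > 0"
    have "(\<lambda>T. B * absv x ^ T) \<longlonglongrightarrow> B * 0"
      using x by (intro tendsto_intros) auto
    then have "eventually (\<lambda>T. B * absv x ^ T < e) sequentially"
      using \<open>e > 0\<close> by (auto dest: order_tendstoD)
    then obtain S where S: "\<And>T. T \<ge> S \<Longrightarrow> B * absv x ^ T < e"
      by (auto simp: eventually_sequentially)
    have "dist (poly (truncation f m) x) (poly (truncation f n) x) < e" if "m \<ge> S" "n > m" for m n
      using absv_poly_truncation_diff_le[OF B(1), of x m n] x S[of m] that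
      by (simp add: dist_absv absv_diff_commute)
    then show "\<exists>S. \<forall>m\<ge>S. \<forall>n>m. dist (poly (truncation f m) x) (poly (truncation f n) x) < e"
      by blast
  qed
  then obtain l where l: "(\<lambda>T. poly (truncation f T) x) \<longlonglongrightarrow> l"
    using Cauchy_convergent_iff convergent_def by blast
  then have "(\<lambda>n. fps_nth (fps_of_hinf f) n * x ^ n) sums l"
    by (simp add: sums_def poly_truncation)
  then have "hinf_eval f x = l"
    unfolding hinf_eval_def by (rule sums_unique[symmetric])
  then show ?thesis using l by simp
qed

lemma tendsto_absv:
  assumes "(g \<longlongrightarrow> (l :: 'a :: complete_alg_closed_nonarch_field)) F"
  shows "((\<lambda>n. absv (g n - c)) \<longlongrightarrow> absv (l - c)) F"
  using tendsto_dist[OF assms tendsto_const[of c]] by (simp add: dist_absv)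

lemma absv_truncation_tendsto:
  assumes "x \<in> ball 0 1"
  shows "(\<lambda>T. absv (poly (truncation f T) x)) \<longlonglongrightarrow> absv (hinf_eval f x)"
  using tendsto_absv[OF truncation_tendsto[OF assms], where c = 0] by simp

text \<open>
  The convergence of the truncations is uniform on disks of radius less than 1. This matters where
  the point of evaluation depends on the truncation.
\<close>

lemma absv_hinf_eval_diff_truncation_le:
  assumes "coeff_bound f B" "x \<in> ball 0 1"
  shows "absv (hinf_eval f x - poly (truncation f S) x) \<le> B * absv x ^ S"
proof (rule tendsto_upperbound[OF tendsto_absv[OF truncation_tendsto[OF assms(2)]]])
  show "\<forall>\<^sub>F T in sequentially. absv (poly (truncation f T) x - poly (truncation f S) x) \<le> B * absv x ^ S"
    using eventually_ge_at_top[of S]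
  proof eventually_elim
    case (elim T)
    then show ?case
      using absv_poly_truncation_diff_le[OF assms(1)] assms(2) by (simp add: dist_absv)
  qed
qed simp

lemma absv_hinf_eval_le:
  assumes "coeff_bound f B" "x \<in> ball 0 1"
  shows "absv (hinf_eval f x) \<le> B"
  using absv_hinf_eval_diff_truncation_le[OF assms, of 0] by (simp add: truncation_def)

lemma absv_hinf_eval_le_zeta_disk:
  assumes "D \<subseteq> ball 0 1" "x \<in> D"
  shows "absv (hinf_eval f x) \<le> zeta_disk D f"
proof -
  obtain B where "coeff_bound f B" using coeff_bound_exists by blast
  then have "bdd_above ((\<lambda>x. absv (hinf_eval f x)) ` D)"
    using assms absv_hinf_eval_le by (intro bdd_aboveI2[of _ _ B]) blast
  then show ?thesis
    unfolding zeta_disk_def using assms(2) by (rule cSUP_upper2) auto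
qed

lemma zeta_disk_least:
  assumes "D \<noteq> {}" "\<And>x. x \<in> D \<Longrightarrow> absv (hinf_eval f x) \<le> c"
  shows "zeta_disk D f \<le> c"
  unfolding zeta_disk_def using assms by (rule cSUP_least)

lemma zeta_disk_mono:
  assumes "D \<noteq> {}" "D \<subseteq> E" "E \<subseteq> ball 0 1"
  shows "zeta_disk D f \<le> zeta_disk E f"
  using assms by (intro zeta_disk_least absv_hinf_eval_le_zeta_disk) auto

lemma zeta_disk_nonneg:
  assumes "D \<noteq> {}" "D \<subseteq> ball 0 1"
  shows "0 \<le> zeta_disk D f"
  using assms absv_hinf_eval_le_zeta_disk absv_nonneg order_trans by blast

lemma zeta_disk_le:
  assumes "coeff_bound f B" "D \<noteq> {}" "D \<subseteq> ball 0 1"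
  shows "zeta_disk D f \<le> B"
  using assms absv_hinf_eval_le by (intro zeta_disk_least) blast+

section \<open>The number of zeros in a disk\<close>

text \<open>
  As a function of the logarithm of the radius \<open>\<sigma>\<close>, the logarithm of the seminorm of \<open>f\<close> over the
  disk of radius \<open>\<sigma>\<close> around \<open>z\<close> is convex and piecewise linear, and its slopes count zeros. So, for
  \<open>f \<noteq> 0\<close>, \<open>zero_order_le f z \<rho> N\<close> means that \<open>f\<close> has at most \<open>N\<close> zeros at distance less than \<open>\<rho>\<close>
  from \<open>z\<close>, and \<open>zero_order f z \<rho>\<close> is their number. Expressed by growth, the notion
  passes to limits of truncations.
\<close>

definition zero_order_le ::
    "'a :: complete_alg_closed_nonarch_field hinf \<Rightarrow> 'a \<Rightarrow> real \<Rightarrow> nat \<Rightarrow> bool" where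
  "zero_order_le f z \<rho> N \<longleftrightarrow> (\<forall>\<sigma>. 0 < \<sigma> \<and> \<sigma> \<le> \<rho> \<longrightarrow>
     (\<sigma> / \<rho>) ^ N * zeta_disk (cball z \<rho>) f \<le> zeta_disk (cball z \<sigma>) f)"

definition zero_order :: "'a :: complete_alg_closed_nonarch_field hinf \<Rightarrow> 'a \<Rightarrow> real \<Rightarrow> nat" where
  "zero_order f z \<rho> = (LEAST N. zero_order_le f z \<rho> N)"

text \<open>
  Estimate \<open>absv_poly_ge_on_smaller_disk\<close> passes from infinitely many truncations to the limit \<open>f\<close>,
  and then from \<open>a < \<sigma>\<close> to \<open>a = \<sigma>\<close>.
\<close>

lemma zero_order_le_of_frequently:
  assumes \<rho>: "0 < \<rho>" "\<rho> < 1" and z: "z \<in> ball 0 1"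
    and freq: "\<exists>\<^sub>F T in sequentially. root_count (truncation f T) (cball z \<rho>) \<le> N"
  shows "zero_order_le f z \<rho> N"
  unfolding zero_order_le_def
proof (intro allI impI, elim conjE)
  fix \<sigma> assume \<sigma>: "0 < \<sigma>" "\<sigma> \<le> \<rho>"
  obtain B where B: "coeff_bound f B" "B > 0"
    using coeff_bound_exists by blast
  define R where "R = max (absv z) \<rho>"
  have R: "0 \<le> R" "R < 1"
    using \<rho> z by (auto simp: R_def dist_absv)
  have Rx: "absv x \<le> R" if "x \<in> cball z \<rho>" for x
    using that absv_diff_le_max[of x 0 z] by (auto simp: R_def dist_absv absv_diff_commute)
  have in_ball: "cball z \<rho> \<subseteq> ball 0 1"
    using cball_subset_unit_ball \<rho> z by blast
  have sub: "cball z \<sigma> \<subseteq> cball z \<rho>" using \<sigma> by auto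
  let ?\<zeta> = "zeta_disk (cball z \<sigma>) f"
  have approx: "absv (hinf_eval f x - poly (truncation f T) x) \<le> B * R ^ T" if "x \<in> cball z \<rho>" for x T
  proof -
    have "absv (hinf_eval f x - poly (truncation f T) x) \<le> B * absv x ^ T"
      using absv_hinf_eval_diff_truncation_le B(1) that in_ball by blast
    also have "\<dots> \<le> B * R ^ T"
      using Rx[OF that] B by (intro mult_left_mono power_mono) auto
    finally show ?thesis .
  qed
  have lower: "(a / \<rho>) ^ N * absv (hinf_eval f x) \<le> ?\<zeta>"
    if x: "x \<in> cball z \<rho>" and a: "0 < a" "a < \<sigma>" for a x
  proof (rule ccontr)
    assume "\<not> ?thesis"
    moreover have "(\<lambda>T. (a / \<rho>) ^ N * absv (poly (truncation f T) x) - B * R ^ T)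
        \<longlonglongrightarrow> (a / \<rho>) ^ N * absv (hinf_eval f x) - B * 0"
      using R by (intro tendsto_intros absv_truncation_tendsto) (use x in_ball in auto)
    ultimately have "eventually (\<lambda>T. ?\<zeta> < (a / \<rho>) ^ N * absv (poly (truncation f T) x) - B * R ^ T)
        sequentially"
      by (intro order_tendstoD(1)) auto
    from frequently_eventually_conj[OF freq this]
    obtain T where T: "root_count (truncation f T) (cball z \<rho>) \<le> N"
        "?\<zeta> < (a / \<rho>) ^ N * absv (poly (truncation f T) x) - B * R ^ T"
      by (auto dest: frequently_ex)
    obtain y where y: "y \<in> cball z \<sigma>"
      "(a / \<rho>) ^ root_count (truncation f T) (cball z \<rho>) * absv (poly (truncation f T) x)
         \<le> absv (poly (truncation f T) y)"
      using absv_poly_ge_on_smaller_disk[OF a \<sigma>(2) x] by blast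
    have "(a / \<rho>) ^ N * absv (poly (truncation f T) x) \<le> absv (poly (truncation f T) y)"
      using T(1) a \<sigma> by (intro order_trans[OF _ y(2)] mult_right_mono power_decreasing) auto
    also have "\<dots> \<le> max (absv (hinf_eval f y)) (B * R ^ T)"
      using approx[of y T] y(1) sub
        absv_diff_le_max[of "poly (truncation f T) y" 0 "hinf_eval f y"]
      by (auto simp: absv_diff_commute)
    also have "\<dots> \<le> ?\<zeta> + B * R ^ T"
      using absv_hinf_eval_le_zeta_disk[OF _ y(1)] sub in_ball B R
        zeta_disk_nonneg[of "cball z \<sigma>" f] \<sigma> by (auto intro: add_increasing add_increasing2)
    finally show False using T(2) by simp
  qed
  have "(\<sigma> / \<rho>) ^ N * absv (hinf_eval f x) \<le> ?\<zeta>" if x: "x \<in> cball z \<rho>" for x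
  proof (rule tendsto_upperbound)
    show "((\<lambda>a. (a / \<rho>) ^ N * absv (hinf_eval f x)) \<longlongrightarrow> (\<sigma> / \<rho>) ^ N * absv (hinf_eval f x)) (at_left \<sigma>)"
      using \<rho> by (intro tendsto_intros) auto
    show "\<forall>\<^sub>F a in at_left \<sigma>. (a / \<rho>) ^ N * absv (hinf_eval f x) \<le> ?\<zeta>"
      using eventually_at_left_real[OF \<sigma>(1)] by eventually_elim (use lower x in auto)
  qed simp
  then have "zeta_disk (cball z \<rho>) f \<le> ?\<zeta> / (\<sigma> / \<rho>) ^ N"
    using \<sigma> \<rho> by (intro zeta_disk_least) (auto simp: field_simps)
  then show "(\<sigma> / \<rho>) ^ N * zeta_disk (cball z \<rho>) f \<le> ?\<zeta>"
    using \<sigma> \<rho> by (simp add: field_simps)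
qed

text \<open>
  Some finite order exists: if \<open>f\<close> does not vanish at \<open>x\<close>, the number of roots of the truncations in
  the disk is bounded, because each such root contributes a factor at most \<open>\<rho> < 1\<close> to the value at
  \<open>x\<close>, while the Gauss norms are bounded.
\<close>

lemma zero_order_le_zero_order:
  assumes \<rho>: "0 < \<rho>" "\<rho> < 1" and z: "z \<in> ball 0 1"
  shows "zero_order_le f z \<rho> (zero_order f z \<rho>)"
proof -
  have in_ball: "cball z \<rho> \<subseteq> ball 0 1"
    using cball_subset_unit_ball \<rho> z by blast
  have "\<exists>N. zero_order_le f z \<rho> N"
  proof (cases "\<exists>x\<in>cball z \<rho>. absv (hinf_eval f x) > 0")
    case False
    then have "zeta_disk (cball z \<rho>) f \<le> 0"
      using \<rho> by (intro zeta_disk_least) force+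
    moreover have "0 \<le> zeta_disk (cball z \<sigma>) f" if "0 < \<sigma>" "\<sigma> \<le> \<rho>" for \<sigma>
      using that in_ball by (intro zeta_disk_nonneg) auto
    ultimately have "zero_order_le f z \<rho> 0"
      by (force simp: zero_order_le_def)
    then show ?thesis ..
  next
    case True
    then obtain x where x: "x \<in> cball z \<rho>" "absv (hinf_eval f x) > 0" by blast
    define c where "c = absv (hinf_eval f x) / 2"
    obtain B where B: "coeff_bound f B" "B > 0"
      using coeff_bound_exists by blast
    obtain N where N: "\<rho> ^ N < c / B"
      using real_arch_pow_inv[of "c / B" \<rho>] x B \<rho> by (auto simp: c_def)
    have "eventually (\<lambda>T. c < absv (poly (truncation f T) x)) sequentially"
      using order_tendstoD(1)[OF absv_truncation_tendsto, of x c] x in_ball by (auto simp: c_def)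
    then have "eventually (\<lambda>T. root_count (truncation f T) (cball z \<rho>) \<le> N) sequentially"
    proof eventually_elim
      case (elim T)
      \<comment> \<open>A family of disks with the single index 0.\<close>
      have "absv (poly (truncation f T) x) \<le> gauss_norm (truncation f T)
          * (\<Prod>j\<in>{0::nat}. \<rho> ^ root_count (truncation f T) (cball z \<rho>))"
      proof (intro absv_poly_le_roots_in_disjoint_sets)
        show "absv (x - w) \<le> \<rho>" if "w \<in> cball z \<rho>" for w
          using absv_diff_le_max[of x w z] that x(1) by (simp add: dist_absv absv_diff_commute)
        show "absv x \<le> 1"
          using x(1) in_ball by (force simp: dist_absv)
      qed (use \<rho> in \<open>auto simp: disjoint_family_on_def\<close>)
      also have "\<dots> \<le> B * \<rho> ^ root_count (truncation f T) (cball z \<rho>)"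
        using gauss_norm_truncation_le[OF B(1), of T] \<rho> by (auto intro: mult_right_mono)
      finally have "c < B * \<rho> ^ root_count (truncation f T) (cball z \<rho>)"
        using elim by simp
      moreover have "B * \<rho> ^ N < c"
        using N B by (simp add: field_simps)
      ultimately have "B * \<rho> ^ N < B * \<rho> ^ root_count (truncation f T) (cball z \<rho>)"
        by simp
      then have "\<rho> ^ N < \<rho> ^ root_count (truncation f T) (cball z \<rho>)"
        using B(2) by simp
      then show ?case
        using \<rho> by (meson linorder_le_cases not_less power_decreasing less_imp_le)
    qed
    then show ?thesis
      using zero_order_le_of_frequently[OF assms] eventually_frequently sequentially_bot by blast
  qed
  then show ?thesis
    unfolding zero_order_def by (rule LeastI_ex)
qed

text \<open>
  Otherwise infinitely many truncations would have fewer roots, and their estimates would pass to the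
  limit and contradict the minimality of the order.
\<close>

lemma eventually_zero_order_le_root_count:
  assumes "0 < \<rho>" "\<rho> < 1" "z \<in> ball 0 1"
  shows "\<forall>\<^sub>F T in sequentially. zero_order f z \<rho> \<le> root_count (truncation f T) (cball z \<rho>)"
proof (rule ccontr)
  assume "\<not> ?thesis"
  then have freq: "\<exists>\<^sub>F T in sequentially. root_count (truncation f T) (cball z \<rho>) < zero_order f z \<rho>"
    by (simp add: not_eventually not_le)
  then have pos: "0 < zero_order f z \<rho>"
    by (auto dest: frequently_ex)
  have "\<exists>\<^sub>F T in sequentially. root_count (truncation f T) (cball z \<rho>) \<le> zero_order f z \<rho> - 1"
    using freq by (rule frequently_mono[rotated]) auto
  then have "zero_order f z \<rho> \<le> zero_order f z \<rho> - 1"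
    using zero_order_le_of_frequently[OF assms] Least_le unfolding zero_order_def by metis
  then show False using pos by simp
qed

text \<open>
  Jensen's inequality for bounded power series. As \<open>t j \<le> 1\<close>, it suffices that the root counts of the
  truncations are eventually at least the orders of \<open>f\<close>.
\<close>

lemma absv_hinf_eval_le_zeros_in_disjoint_disks:
  assumes B: "coeff_bound f B"
    and F: "finite F" "disjoint_family_on (\<lambda>j. cball (z j) (\<rho> j)) F"
    and \<rho>: "\<And>j. j \<in> F \<Longrightarrow> 0 < \<rho> j" "\<And>j. j \<in> F \<Longrightarrow> \<rho> j < 1"
    and z: "\<And>j. j \<in> F \<Longrightarrow> z j \<in> ball 0 1"
    and t: "\<And>j w. j \<in> F \<Longrightarrow> w \<in> cball (z j) (\<rho> j) \<Longrightarrow> absv (x - w) \<le> t j"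
    and t01: "\<And>j. j \<in> F \<Longrightarrow> 0 \<le> t j" "\<And>j. j \<in> F \<Longrightarrow> t j \<le> 1"
    and x: "x \<in> ball 0 1"
  shows "absv (hinf_eval f x) \<le> B * (\<Prod>j\<in>F. t j ^ zero_order f (z j) (\<rho> j))"
proof (rule tendsto_upperbound[OF absv_truncation_tendsto[OF x]])
  have "\<forall>\<^sub>F T in sequentially.
      \<forall>j\<in>F. zero_order f (z j) (\<rho> j) \<le> root_count (truncation f T) (cball (z j) (\<rho> j))"
    using F(1) \<rho> z
    by (intro eventually_ball_finite ballI eventually_zero_order_le_root_count) auto
  then show "\<forall>\<^sub>F T in sequentially. absv (poly (truncation f T) x)
      \<le> B * (\<Prod>j\<in>F. t j ^ zero_order f (z j) (\<rho> j))"
  proof eventually_elim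
    case (elim T)
    have "absv (poly (truncation f T) x) \<le> gauss_norm (truncation f T)
        * (\<Prod>j\<in>F. t j ^ root_count (truncation f T) (cball (z j) (\<rho> j)))"
      using x by (intro absv_poly_le_roots_in_disjoint_sets F t t01) (auto simp: dist_absv)
    also have "\<dots> \<le> B * (\<Prod>j\<in>F. t j ^ zero_order f (z j) (\<rho> j))"
      using elim t01 by (intro mult_mono gauss_norm_truncation_le B coeff_bound_nonneg[OF B]
          prod_mono prod_nonneg conjI power_decreasing zero_le_power) auto
    finally show ?case .
  qed
qed simp

section \<open>Compatible sequences of exponents\<close>

lemma prod_antimono_subset:
  fixes a :: "'b \<Rightarrow> real"
  assumes "finite B" "A \<subseteq> B" "\<And>j. 0 \<le> a j" "\<And>j. a j \<le> 1"
  shows "prod a B \<le> prod a A"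
proof -
  have "prod a B = prod a (B - A) * prod a A"
    using assms(1,2) by (simp add: prod.subset_diff)
  also have "\<dots> \<le> 1 * prod a A"
    using assms by (intro mult_right_mono prod_le_1 prod_nonneg) auto
  finally show ?thesis by simp
qed

lemma prod_over_tendsto:
  assumes "\<And>j. 0 \<le> a j" "\<And>j. a j \<le> 1"
  shows "(\<lambda>N. \<Prod>j\<in>{j\<in>A. j < N}. a j) \<longlonglongrightarrow> prod_over a A"
proof -
  have "decseq (\<lambda>N. \<Prod>j\<in>{j\<in>A. j < N}. a j)"
    unfolding decseq_def using assms
    by (intro allI impI prod_antimono_subset) (auto intro: finite_subset[of _ "{..<_}"] dest: order_less_le_trans)
  moreover have "\<forall>N. 0 \<le> (\<Prod>j\<in>{j\<in>A. j < N}. a j)"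
    using assms by (simp add: prod_nonneg)
  ultimately have "convergent (\<lambda>N. \<Prod>j\<in>{j\<in>A. j < N}. a j)"
    using decseq_convergent[of _ 0] unfolding convergent_def by metis
  then show ?thesis
    by (simp add: prod_over_def convergent_LIMSEQ_iff)
qed

lemma le_prod_over_iff:
  assumes "\<And>j. 0 \<le> a j" "\<And>j. a j \<le> 1"
  shows "c \<le> prod_over a A \<longleftrightarrow> (\<forall>F. finite F \<and> F \<subseteq> A \<longrightarrow> c \<le> prod a F)"
proof (intro iffI allI impI)
  fix F assume c: "c \<le> prod_over a A" and F: "finite F \<and> F \<subseteq> A"
  have "prod_over a A \<le> prod a F"
  proof (rule tendsto_upperbound[OF prod_over_tendsto[of a, OF assms]])
    show "\<forall>\<^sub>F N in sequentially. (\<Prod>j\<in>{j\<in>A. j < N}. a j) \<le> prod a F"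
      using eventually_gt_at_top[of "Max (insert 0 F)"]
    proof eventually_elim
      case (elim N)
      then show ?case
        using F assms by (intro prod_antimono_subset) (auto intro: finite_subset[of _ "{..<N}"])
    qed
  qed simp
  then show "c \<le> prod a F" using c by simp
next
  assume "\<forall>F. finite F \<and> F \<subseteq> A \<longrightarrow> c \<le> prod a F"
  then show "c \<le> prod_over a A"
    by (intro tendsto_lowerbound[OF prod_over_tendsto[of a, OF assms]])
      (auto intro!: always_eventually)
qed

text \<open>
  Regularity and compatibility amount to a uniform lower bound for finite products. In this form,
  they are inherited by subsets of \<open>C\<close>, and products can be multiplied and compared factor by factor.
\<close>

lemma INF_prod_over_pos_iff:
  assumes "C \<noteq> {}" "\<And>n j. n \<in> C \<Longrightarrow> 0 \<le> a n j" "\<And>n j. n \<in> C \<Longrightarrow> a n j \<le> 1"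
  shows "(INF n\<in>C. prod_over (a n) (C - {n})) > 0 \<longleftrightarrow>
    (\<exists>\<delta>>0. \<forall>n\<in>C. \<forall>F. finite F \<and> F \<subseteq> C - {n} \<longrightarrow> \<delta> \<le> prod (a n) F)"
proof -
  have iff: "\<delta> \<le> prod_over (a n) (C - {n}) \<longleftrightarrow> (\<forall>F. finite F \<and> F \<subseteq> C - {n} \<longrightarrow> \<delta> \<le> prod (a n) F)"
    if "n \<in> C" for n \<delta>
    using that assms by (intro le_prod_over_iff) auto
  have "0 \<le> prod_over (a n) (C - {n})" if "n \<in> C" for n
    unfolding iff[OF that] using that assms by (auto intro: prod_nonneg)
  then have bdd: "bdd_below ((\<lambda>n. prod_over (a n) (C - {n})) ` C)"
    by (intro bdd_belowI2[of _ 0]) auto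
  have eq: "(\<exists>\<delta>>0. \<forall>n\<in>C. \<forall>F. finite F \<and> F \<subseteq> C - {n} \<longrightarrow> \<delta> \<le> prod (a n) F) \<longleftrightarrow>
      (\<exists>\<delta>>0. \<forall>n\<in>C. \<delta> \<le> prod_over (a n) (C - {n}))"
    by (simp add: iff)
  show ?thesis
    unfolding eq
  proof
    assume pos: "(INF n\<in>C. prod_over (a n) (C - {n})) > 0" (is "?I > 0")
    have "?I \<le> prod_over (a n) (C - {n})" if "n \<in> C" for n
      using bdd that by (rule cINF_lower)
    then show "\<exists>\<delta>>0. \<forall>n\<in>C. \<delta> \<le> prod_over (a n) (C - {n})"
      using pos by blast
  next
    assume "\<exists>\<delta>>0. \<forall>n\<in>C. \<delta> \<le> prod_over (a n) (C - {n})"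
    then obtain \<delta> where \<delta>: "\<delta> > 0" "\<And>n. n \<in> C \<Longrightarrow> \<delta> \<le> prod_over (a n) (C - {n})"
      by blast
    then have "\<delta> \<le> (INF n\<in>C. prod_over (a n) (C - {n}))"
      using assms(1) by (intro cINF_greatest) auto
    then show "(INF n\<in>C. prod_over (a n) (C - {n})) > 0"
      using \<delta>(1) by simp
  qed
qed

lemma mem_Comp_iff:
  assumes "u \<noteq> bot" "\<And>n. z n \<in> ball 0 1"
  shows "m \<in> Comp u z \<longleftrightarrow> (\<forall>n. 1 \<le> m n) \<and> (\<exists>C. large C u \<and> (\<exists>\<delta>>0. \<forall>n\<in>C.
    \<forall>F. finite F \<and> F \<subseteq> C - {n} \<longrightarrow> \<delta> \<le> (\<Prod>j\<in>F. absv (z n - z j) ^ m j)))"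
proof -
  have "C \<noteq> {}" if "large C u" for C
    using that assms(1) by (auto simp: large_def trivial_limit_def)
  moreover have "absv (z n - z j) ^ m j \<le> 1" for n j
    using absv_diff_less_1[OF assms(2) assms(2)] by (simp add: power_le_one less_imp_le)
  ultimately have "(INF n\<in>C. prod_over (\<lambda>j. absv (z n - z j) ^ m j) (C - {n})) > 0 \<longleftrightarrow>
      (\<exists>\<delta>>0. \<forall>n\<in>C. \<forall>F. finite F \<and> F \<subseteq> C - {n} \<longrightarrow> \<delta> \<le> (\<Prod>j\<in>F. absv (z n - z j) ^ m j))"
    if "large C u" for C
    using that by (intro INF_prod_over_pos_iff) simp_all
  then show ?thesis
    unfolding Comp_def mem_Collect_eq by meson
qed

lemma CompE:
  assumes "u \<noteq> bot" "\<And>n. z n \<in> ball 0 1" "m \<in> Comp u z"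
  obtains C \<delta> where "large C u" "\<delta> > 0"
    "\<And>n F. n \<in> C \<Longrightarrow> finite F \<Longrightarrow> F \<subseteq> C - {n} \<Longrightarrow> \<delta> \<le> (\<Prod>j\<in>F. absv (z n - z j) ^ m j)"
proof -
  have "\<exists>C. large C u \<and> (\<exists>\<delta>>0. \<forall>n\<in>C.
    \<forall>F. finite F \<and> F \<subseteq> C - {n} \<longrightarrow> \<delta> \<le> (\<Prod>j\<in>F. absv (z n - z j) ^ m j))"
    using assms(3) unfolding mem_Comp_iff[OF assms(1,2)] by (rule conjunct2)
  then show ?thesis
    by (elim exE conjE) (rule that, auto)
qed

lemma const_1_mem_Comp_iff_regular: "(\<lambda>_. 1) \<in> Comp u z \<longleftrightarrow> regular_seq u z"
  by (simp add: Comp_def regular_seq_def)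

lemma large_Int: "large C u \<Longrightarrow> large D u \<Longrightarrow> large (C \<inter> D) u"
  by (auto simp: large_def eventually_conj_iff)

text \<open>
  Passing from \<open>m\<close> to \<open>c m\<close> raises the products to the power \<open>c\<close>, which keeps them away from 0, and
  decreasing an exponent increases them, because the distances are less than 1.
\<close>

lemma Comp_if_eventually_le_mult:
  assumes "u \<noteq> bot" and z: "\<And>n. z n \<in> ball 0 1"
    and m: "m \<in> Comp u z" and k: "\<And>n. 1 \<le> k n"
    and le: "eventually (\<lambda>n. k n \<le> c * m n) u"
  shows "k \<in> Comp u z"
proof -
  obtain C \<delta> where C: "large C u" "\<delta> > 0"
    "\<And>n F. n \<in> C \<Longrightarrow> finite F \<Longrightarrow> F \<subseteq> C - {n} \<Longrightarrow> \<delta> \<le> (\<Prod>j\<in>F. absv (z n - z j) ^ m j)"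
    using CompE[OF assms(1,2) m] by metis
  define D where "D = C \<inter> {n. k n \<le> c * m n}"
  have "large D u"
    unfolding D_def using C(1) le by (intro large_Int) (auto simp: large_def)
  moreover have "\<delta> ^ c \<le> (\<Prod>j\<in>F. absv (z n - z j) ^ k j)"
    if "n \<in> D" "finite F" "F \<subseteq> D - {n}" for n F
  proof -
    have "\<delta> ^ c \<le> (\<Prod>j\<in>F. absv (z n - z j) ^ m j) ^ c"
      using C(2) C(3)[of n F] that by (intro power_mono) (auto simp: D_def)
    also have "\<dots> = (\<Prod>j\<in>F. absv (z n - z j) ^ (c * m j))"
      by (simp only: mult.commute[of c] power_mult prod_power_distrib)
    also have "\<dots> \<le> (\<Prod>j\<in>F. absv (z n - z j) ^ k j)"
      using that(3) absv_diff_less_1[OF z z]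
      by (intro prod_mono conjI power_decreasing) (auto simp: D_def less_imp_le)
    finally show ?thesis .
  qed
  ultimately show ?thesis
    unfolding mem_Comp_iff[OF assms(1,2)]
    using k C(2) by (intro conjI exI[of _ D] exI[of _ "\<delta> ^ c"]) auto
qed

section \<open>Limits of seminorms along an ultrafilter\<close>

lemma tendsto_Lim_ultrafilter:
  fixes g :: "'b \<Rightarrow> 'c :: t2_space"
  assumes "nonprincipal_ultrafilter u" "compact K" "eventually (\<lambda>n. g n \<in> K) u"
  shows "(g \<longlongrightarrow> Lim u g) u"
proof -
  have u: "u \<noteq> bot" "\<And>P. eventually P u \<or> eventually (\<lambda>x. \<not> P x) u"
    using assms(1) by (auto simp: nonprincipal_ultrafilter_def)
  have "filtermap g u \<noteq> bot"
    using u(1) by (simp add: filtermap_bot_iff)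
  then obtain l where l: "inf (nhds l) (filtermap g u) \<noteq> bot"
    using assms(2)[unfolded compact_filter, rule_format, of "filtermap g u"] assms(3)
    by (auto simp: eventually_filtermap)
  have "(g \<longlongrightarrow> l) u"
  proof (rule topological_tendstoI, rule ccontr)
    fix S assume S: "open S" "l \<in> S" and "\<not> eventually (\<lambda>n. g n \<in> S) u"
    then have "eventually (\<lambda>y. y \<notin> S) (filtermap g u)"
      using u(2) by (auto simp: eventually_filtermap)
    moreover have "eventually (\<lambda>y. y \<in> S) (nhds l)"
      using S by (rule eventually_nhds_in_open)
    ultimately have "eventually (\<lambda>_. False) (inf (nhds l) (filtermap g u))"
      unfolding eventually_inf by (intro exI[of _ "\<lambda>y. y \<in> S"] exI[of _ "\<lambda>y. y \<notin> S"]) simp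
    then show False
      using l trivial_limit_def by blast
  qed
  then show ?thesis
    using u(1) tendsto_Lim by blast
qed

locale disk_limits =
  fixes u :: "nat filter" and z :: "nat \<Rightarrow> 'a :: complete_alg_closed_nonarch_field"
  assumes u: "nonprincipal_ultrafilter u" and z: "\<And>n. z n \<in> ball 0 1"
begin

lemma u_nontrivial: "u \<noteq> bot"
  using u by (simp add: nonprincipal_ultrafilter_def)

lemma root_cball:
  assumes "1 \<le> (m::nat)" "0 < s" "s < 1"
  shows "0 < root m s" "root m s < 1" "cball (z n) (root m s) \<noteq> {}"
    "cball (z n) (root m s) \<subseteq> ball 0 1"
proof -
  show *: "0 < root m s" "root m s < 1"
    using assms by (auto simp: real_root_gt_zero real_root_lt_1_iff)
  then show "cball (z n) (root m s) \<noteq> {}" "cball (z n) (root m s) \<subseteq> ball 0 1"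
    using cball_subset_unit_ball[OF z] by auto
qed

lemma zeta_lim_tendsto:
  assumes m: "\<And>n. 1 \<le> m n" and s: "0 < s" "s < 1"
  shows "((\<lambda>n. zeta_disk (cball (z n) (root (m n) s)) f) \<longlongrightarrow> zeta_lim u z m s f) u"
proof -
  obtain B where B: "coeff_bound f B" using coeff_bound_exists by blast
  have "zeta_disk (cball (z n) (root (m n) s)) f \<in> {0..B}" for n
    using zeta_disk_nonneg[OF root_cball(3,4)[OF m s]] zeta_disk_le[OF B root_cball(3,4)[OF m s]]
    by simp
  then show ?thesis
    unfolding zeta_lim_def by (intro tendsto_Lim_ultrafilter[OF u, of "{0..B}"]) auto
qed

lemma zeta_lim_nonneg:
  assumes "\<And>n. 1 \<le> m n" "0 < s" "s < 1"
  shows "0 \<le> zeta_lim u z m s f"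
  by (rule tendsto_lowerbound[OF zeta_lim_tendsto[OF assms]])
    (simp_all add: zeta_disk_nonneg[OF root_cball(3,4)[OF assms]] u_nontrivial)

lemma zeta_lim_le_zeta_lim:
  assumes m: "\<And>n. 1 \<le> m n" "0 < s" "s < 1" and k: "\<And>n. 1 \<le> k n" "0 < r" "r < 1"
    and le: "eventually (\<lambda>n. root (m n) s \<le> root (k n) r) u"
  shows "zeta_lim u z m s f \<le> zeta_lim u z k r f"
  using u_nontrivial zeta_lim_tendsto[OF k] zeta_lim_tendsto[OF m]
proof (rule tendsto_le)
  show "\<forall>\<^sub>F n in u. zeta_disk (cball (z n) (root (m n) s)) f \<le> zeta_disk (cball (z n) (root (k n) r)) f"
    using le by eventually_elim (intro zeta_disk_mono root_cball m k subset_cball)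
qed

text \<open>The limit from the left exists because \<open>zeta_lim\<close> is bounded and increasing in \<open>s\<close>.\<close>

lemma zeta_one_tendsto:
  assumes m: "\<And>n. 1 \<le> m n"
  shows "((\<lambda>s. zeta_lim u z m s f) \<longlongrightarrow> zeta_one u z m f) (at_left 1)"
proof -
  obtain B where B: "coeff_bound f B" using coeff_bound_exists by blast
  define L where "L = (SUP s\<in>{0<..<1}. zeta_lim u z m s f)"
  have mono: "zeta_lim u z m s f \<le> zeta_lim u z m t f" if "0 < s" "s \<le> t" "t < 1" for s t
    using that m by (intro zeta_lim_le_zeta_lim always_eventually) (auto simp: Suc_le_eq)
  have "zeta_lim u z m s f \<le> B" if "0 < s" "s < 1" for s
    by (rule tendsto_upperbound[OF zeta_lim_tendsto[OF m that]])
      (simp_all add: zeta_disk_le[OF B root_cball(3,4)[OF m that]] u_nontrivial)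
  then have bdd: "bdd_above ((\<lambda>s. zeta_lim u z m s f) ` {0<..<1})"
    by (intro bdd_aboveI2[of _ _ B]) auto
  have upper: "zeta_lim u z m s f \<le> L" if "0 < s" "s < 1" for s
    unfolding L_def using bdd that by (intro cSUP_upper) auto
  have "((\<lambda>s. zeta_lim u z m s f) \<longlongrightarrow> L) (at_left 1)"
  proof (rule order_tendstoI)
    fix a assume "a < L"
    then obtain s where s: "0 < s" "s < 1" "a < zeta_lim u z m s f"
      unfolding L_def using less_cSUP_iff[OF _ bdd] by auto
    have "\<forall>\<^sub>F t in at_left 1. t \<in> {s<..<1}"
      using s by (intro eventually_at_left_real)
    then show "\<forall>\<^sub>F t in at_left 1. a < zeta_lim u z m t f"
    proof eventually_elim
      case (elim t)
      then show ?case using s mono[of s t] by simp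
    qed
  next
    fix a assume "L < a"
    have "\<forall>\<^sub>F t in at_left (1::real). t \<in> {0<..<1}"
      by (intro eventually_at_left_real) simp
    then show "\<forall>\<^sub>F t in at_left 1. zeta_lim u z m t f < a"
    proof eventually_elim
      case (elim t)
      then show ?case using upper[of t] \<open>L < a\<close> by simp
    qed
  qed
  then show ?thesis
    unfolding zeta_one_def by (simp add: tendsto_Lim)
qed

lemma zeta_one_le:
  assumes m: "\<And>n. 1 \<le> m n" and le: "\<And>s. 0 < s \<Longrightarrow> s < 1 \<Longrightarrow> zeta_lim u z m s f \<le> c"
  shows "zeta_one u z m f \<le> c"
proof (rule tendsto_upperbound[OF zeta_one_tendsto[OF m]])
  have "\<forall>\<^sub>F t in at_left (1::real). t \<in> {0<..<1}"
    by (intro eventually_at_left_real) simp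
  then show "\<forall>\<^sub>F t in at_left 1. zeta_lim u z m t f \<le> c"
    by eventually_elim (use le in auto)
qed simp

lemma zeta_one_ge:
  assumes m: "\<And>n. 1 \<le> m n"
    and ge: "\<And>s. 0 < s \<Longrightarrow> s < 1 \<Longrightarrow> s * c \<le> zeta_lim u z m s f"
  shows "c \<le> zeta_one u z m f"
proof -
  have "1 * c \<le> zeta_one u z m f"
  proof (rule tendsto_le[OF _ zeta_one_tendsto[OF m]])
    show "((\<lambda>s. s * c) \<longlongrightarrow> 1 * c) (at_left 1)"
      by (intro tendsto_intros)
    have "\<forall>\<^sub>F t in at_left (1::real). t \<in> {0<..<1}"
      by (intro eventually_at_left_real) simp
    then show "\<forall>\<^sub>F s in at_left 1. s * c \<le> zeta_lim u z m s f"
      by eventually_elim (use ge in auto)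
  qed simp
  then show ?thesis by simp
qed

text \<open>
  Pick \<open>c\<close> with \<open>s\<^bsup>c\<^esup> < r\<close>. Were \<open>k\<^sub>n \<le> c m\<^sub>n\<close> on a large set, \<open>k\<close> would be compatible. So, \<open>u\<close> being an
  ultrafilter, \<open>k\<^sub>n > c m\<^sub>n\<close> on a large set.
\<close>

lemma eventually_root_le_root:
  assumes k: "\<And>n. 1 \<le> k n" "k \<notin> Comp u z" and m: "m \<in> Comp u z"
    and r: "0 < r" "r < 1" and s: "0 < s" "s < 1"
  shows "eventually (\<lambda>n. root (m n) s \<le> root (k n) r) u"
proof -
  obtain c where c: "s ^ c < r"
    using real_arch_pow_inv r s by blast
  then have "c > 0" using r by (cases c) auto
  have "\<not> eventually (\<lambda>n. k n \<le> c * m n) u"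
    using Comp_if_eventually_le_mult[OF u_nontrivial z m, of k] k by blast
  then have "eventually (\<lambda>n. c * m n < k n) u"
    using u by (auto simp: nonprincipal_ultrafilter_def not_le)
  then show ?thesis
  proof eventually_elim
    case (elim n)
    have "1 \<le> m n" using m by (simp add: Comp_def)
    have "root (m n) s = root (c * m n) (s ^ c)"
      using \<open>c > 0\<close> \<open>1 \<le> m n\<close> s by (simp add: real_root_mult_exp real_root_power real_root_pos2 mult.commute)
    also have "\<dots> \<le> root (c * m n) r"
      using c \<open>c > 0\<close> \<open>1 \<le> m n\<close> by (intro real_root_le_mono) auto
    also have "\<dots> \<le> root (k n) r"
      using elim \<open>c > 0\<close> \<open>1 \<le> m n\<close> r by (intro real_root_increasing) auto
    finally show ?case .
  qed
qed

text \<open>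
  Jensen's inequality bounds the products with exponents \<open>N\<^sub>j\<close> from below, and regularity those with
  exponents 1. The successor is taken because compatible sequences consist of positive integers.
\<close>

lemma Suc_zero_order_mem_Comp:
  assumes reg: "regular_seq u z"
    and k: "\<And>n. 1 \<le> k n" and r: "0 < r" "r < 1"
    and disj: "large C u" "disjoint_family_on (\<lambda>n. cball (z n) (root (k n) r)) C"
    and pos: "0 < zeta_lim u z k r f"
  shows "(\<lambda>n. Suc (zero_order f (z n) (root (k n) r))) \<in> Comp u z"
proof -
  let ?\<rho> = "\<lambda>n. root (k n) r"
  let ?N = "\<lambda>n. zero_order f (z n) (?\<rho> n)"
  obtain B where B: "coeff_bound f B" "B > 0" using coeff_bound_exists by blast
  obtain D \<delta> where D: "large D u" "\<delta> > 0"
    "\<And>n F. n \<in> D \<Longrightarrow> finite F \<Longrightarrow> F \<subseteq> D - {n} \<Longrightarrow> \<delta> \<le> (\<Prod>j\<in>F. absv (z n - z j) ^ 1)"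
    using CompE[OF u_nontrivial z reg[folded const_1_mem_Comp_iff_regular]] by metis
  define c where "c = zeta_lim u z k r f / 2"
  have c: "0 < c" "c < zeta_lim u z k r f" using pos by (auto simp: c_def)
  define E where "E = C \<inter> D \<inter> {n. c < zeta_disk (cball (z n) (?\<rho> n)) f}"
  have "large E u"
    unfolding E_def using disj(1) D(1) order_tendstoD(1)[OF zeta_lim_tendsto[OF k r] c(2)]
    by (intro large_Int) (auto simp: large_def)
  moreover have "\<delta> * (c / B) \<le> (\<Prod>j\<in>F. absv (z n - z j) ^ Suc (?N j))"
    if n: "n \<in> E" and F: "finite F" "F \<subseteq> E - {n}" for n F
  proof -
    have disjoint: "cball (z n) (?\<rho> n) \<inter> cball (z j) (?\<rho> j) = {}" if "j \<in> F" for j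
      using disj(2) that n F(2) unfolding disjoint_family_on_def E_def by blast
    have "zeta_disk (cball (z n) (?\<rho> n)) f \<le> B * (\<Prod>j\<in>F. absv (z n - z j) ^ ?N j)"
    proof (intro zeta_disk_least absv_hinf_eval_le_zeros_in_disjoint_disks B(1) F(1) z
        root_cball(1-3)[OF k r])
      fix x assume x: "x \<in> cball (z n) (?\<rho> n)"
      show "x \<in> ball 0 1" using x root_cball(4)[OF k r] by blast
      show "disjoint_family_on (\<lambda>j. cball (z j) (?\<rho> j)) F"
        using F(2) by (intro disjoint_family_on_mono[OF _ disj(2)]) (auto simp: E_def)
      fix j assume j: "j \<in> F"
      show "0 \<le> absv (z n - z j)" "absv (z n - z j) \<le> 1"
        using absv_diff_less_1[OF z z] by (auto simp: less_imp_le)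
      fix w assume "w \<in> cball (z j) (?\<rho> j)"
      then show "absv (x - w) \<le> absv (z n - z j)"
        using absv_diff_le_of_disjoint_cballs[OF disjoint[OF j] _ _ x] root_cball(1)[OF k r]
        by (simp add: less_imp_le)
    qed
    then have "c / B \<le> (\<Prod>j\<in>F. absv (z n - z j) ^ ?N j)"
      using n B by (simp add: E_def field_simps)
    then have "\<delta> * (c / B) \<le> (\<Prod>j\<in>F. absv (z n - z j) ^ 1) * (\<Prod>j\<in>F. absv (z n - z j) ^ ?N j)"
      using D(2) D(3)[of n F] n F B c by (intro mult_mono) (auto simp: E_def intro: prod_nonneg)
    then show ?thesis by (simp add: prod.distrib)
  qed
  ultimately show ?thesis
    unfolding mem_Comp_iff[OF u_nontrivial z]
    using D(2) c(1) B(2) by (intro conjI exI[of _ E] exI[of _ "\<delta> * (c / B)"]) auto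
qed

text \<open>
  By incompatibility of \<open>k\<close>, the disks with exponents \<open>m\<close> eventually lie inside those with exponents
  \<open>k\<close>, so the definition of the order compares the two seminorms.
\<close>

lemma zeta_lim_le_zeta_one_zero_order:
  assumes k: "\<And>n. 1 \<le> k n" "k \<notin> Comp u z" and r: "0 < r" "r < 1"
    and m_def: "m = (\<lambda>n. Suc (zero_order f (z n) (root (k n) r)))"
    and m: "m \<in> Comp u z"
  shows "zeta_lim u z k r f \<le> zeta_one u z m f"
proof (rule zeta_one_ge)
  show m1: "1 \<le> m n" for n by (simp add: m_def)
  fix s :: real assume s: "0 < s" "s < 1"
  let ?\<rho> = "\<lambda>n. root (k n) r" and ?\<sigma> = "\<lambda>n. root (m n) s"
  show "s * zeta_lim u z k r f \<le> zeta_lim u z m s f"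
  proof (rule tendsto_le[OF u_nontrivial zeta_lim_tendsto[OF m1 s]
        tendsto_mult_left[OF zeta_lim_tendsto[OF k(1) r]]])
    show "\<forall>\<^sub>F n in u. s * zeta_disk (cball (z n) (?\<rho> n)) f \<le> zeta_disk (cball (z n) (?\<sigma> n)) f"
      using eventually_root_le_root[OF k m r s]
    proof eventually_elim
      case (elim n)
      note \<rho> = root_cball[OF k(1) r] and \<sigma> = root_cball[OF m1 s]
      have "s = ?\<sigma> n ^ m n"
        using m1[of n] s by (simp add: real_root_pow_pos2)
      also have "\<dots> \<le> ?\<sigma> n ^ (m n - 1)"
        using \<sigma>(1,2)[of n] by (intro power_decreasing) (auto simp: less_imp_le)
      also have "\<dots> \<le> (?\<sigma> n / ?\<rho> n) ^ (m n - 1)"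
        using \<sigma>(1)[of n] \<rho>(1,2)[of n] by (intro power_mono) (auto simp: field_simps)
      finally have "s * zeta_disk (cball (z n) (?\<rho> n)) f
          \<le> (?\<sigma> n / ?\<rho> n) ^ (m n - 1) * zeta_disk (cball (z n) (?\<rho> n)) f"
        using zeta_disk_nonneg[OF \<rho>(3,4)] by (intro mult_right_mono)
      also have "\<dots> \<le> zeta_disk (cball (z n) (?\<sigma> n)) f"
        using zero_order_le_zero_order[OF \<rho>(1,2) z] \<sigma>(1)[of n] elim
        by (simp add: zero_order_le_def m_def)
      finally show ?case .
    qed
  qed
qed

end

section \<open>Limits of disjoint disks\<close>

theorem theorem2p9:
  fixes u :: "nat filter"
    and z :: "nat \<Rightarrow> 'a :: complete_alg_closed_nonarch_field"
    and k :: "nat \<Rightarrow> nat"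
    and r :: real
    and \<phi> :: "'a hinf \<Rightarrow> real"
  assumes "nonprincipal_ultrafilter u"
    and "\<And>n. z n \<in> ball 0 1"
    and "(\<lambda>n. absv (z n)) \<longlonglongrightarrow> 1"
    and "regular_seq u z"
    and "\<And>n. 1 \<le> k n"
    and "0 < r" "r < 1"
    and "\<exists>C. large C u \<and> disjoint_family_on (\<lambda>n. cball (z n) (root (k n) r)) C"
    and "\<phi> = zeta_lim u z k r"
  shows "\<phi> \<in> M_set u z \<or> \<phi> = (\<lambda>f. SUP m\<in>Comp u z. zeta_one u z m f)"
proof (cases "k \<in> Comp u z")
  case True
  then show ?thesis
    using assms(6,7,9) by (auto simp: M_set_def)
next
  case False
  interpret disk_limits u z
    using assms(1,2) by unfold_locales
  have one: "(\<lambda>_. 1) \<in> Comp u z"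
    using assms(4) by (simp only: const_1_mem_Comp_iff_regular)
  have Comp_ge_1: "1 \<le> m n" if "m \<in> Comp u z" for m n
    using that by (simp add: Comp_def)
  have upper: "zeta_one u z m f \<le> \<phi> f" if m: "m \<in> Comp u z" for m f
    unfolding assms(9) using Comp_ge_1[OF m]
  proof (rule zeta_one_le)
    fix s :: real assume "0 < s" "s < 1"
    then show "zeta_lim u z m s f \<le> zeta_lim u z k r f"
      using Comp_ge_1[OF m] assms(5-7) eventually_root_le_root[OF assms(5) False m assms(6,7)]
      by (intro zeta_lim_le_zeta_lim) auto
  qed
  have attained: "\<exists>m\<in>Comp u z. \<phi> f \<le> zeta_one u z m f" for f
  proof (cases "0 < \<phi> f")
    case True
    define m where "m = (\<lambda>n. Suc (zero_order f (z n) (root (k n) r)))"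
    have "m \<in> Comp u z"
      using Suc_zero_order_mem_Comp assms(4-9) True unfolding m_def by blast
    then show ?thesis
      using zeta_lim_le_zeta_one_zero_order[OF assms(5) False assms(6,7) m_def] assms(9) by auto
  next
    case False
    \<comment> \<open>Here \<open>\<phi> f = 0\<close>, and any compatible sequence will do. Regularity provides the constant 1.\<close>
    have "0 \<le> zeta_one u z (\<lambda>_. 1) f"
      by (rule zeta_one_ge) (auto intro: zeta_lim_nonneg)
    then show ?thesis using one False by force
  qed
  have "\<phi> f = (SUP m\<in>Comp u z. zeta_one u z m f)" for f
  proof (rule antisym)
    obtain m where m: "m \<in> Comp u z" "\<phi> f \<le> zeta_one u z m f"
      using attained by blast
    have "bdd_above ((\<lambda>m. zeta_one u z m f) ` Comp u z)"
      using upper by (intro bdd_aboveI2)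
    then show "\<phi> f \<le> (SUP m\<in>Comp u z. zeta_one u z m f)"
      using m by (intro cSUP_upper2)
    show "(SUP m\<in>Comp u z. zeta_one u z m f) \<le> \<phi> f"
      using one upper by (intro cSUP_least) auto
  qed
  then show ?thesis by blast
qed

end
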